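(* Let $K$ be a simplicial complex over a type $E$, let $s \in K$ be a face, let $x \in E$ with $x \notin V(K)$, and let $\sigma_s K$ be the stellar subdivision of $K$ at $s$ with barycenter $x$. Then, as sets of faces, \[ K = \{t \mid t \in \sigma_s K,\ x \notin t\} \cup \{s \cup (t \setminus \{x\}) \mid t \in \sigma_s K,\ x \in t\} = \big((\sigma_s K) \setminus \mathrm{St}(\sigma_s K, \{x\})\big) \cup \{s \cup (t \setminus \{x\}) \mid t \in \sigma_s K,\ x \in t\}. \]
   Context: A simplicial complex over a type (set) $E$ is a set $K$ of nonempty finite subsets of $E$ (its faces) such that every nonempty subset of a face is a face. It may be empty or infinite, and not every element of $E$ need be a vertex. $V(K) = \{x \in E \mid \{x\} \in K\}$. For a finite set $s \subseteq E$: the link is $\mathrm{Lk}(K,s) = \{t \in K \mid s \cup t \in K,\ s \cap t = \emptyset\}$; the boundary is $\partial s = \{t \subseteq s \mid t \ne \emptyset,\ t \neq s\}$; the star complement, written $K \setminus \mathrm{St}(K,s)$, is $\{t \in K \mid s \not\subseteq t\}$. For complexes $A, B$ over $E$ with disjoint vertex sets, $A \star B$ (regarded as a complex over $E$) has as faces all nonempty sets $a \cup b$ with $a \in A \cup \{\emptyset\}$, $b \in B \cup \{\emptyset\}$. For $s \in K$ and $x \in E \setminus V(K)$, the stellar subdivision of $K$ at $s$ with barycenter $x$ is $\sigma_s K = (K \setminus \mathrm{St}(K,s)) \cup (\mathrm{Lk}(K,s) \star \partial s \star \{x\})$, where $\{x\}$ denotes the complex with single face $\{x\}$. That is, the faces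 of $\sigma_s K$ are the faces of $K$ not containing $s$ together with all nonempty sets $a \cup b \cup c$ with $a \in \mathrm{Lk}(K,s) \cup \{\emptyset\}$, $b \in \partial s \cup \{\emptyset\}$, $c \in \{\emptyset, \{x\}\}$. *)

theory Defs
  imports Main
begin

definition simplicial_complex :: "'a set set \<Rightarrow> bool" where
  "simplicial_complex K \<longleftrightarrow>
     (\<forall>s\<in>K. finite s \<and> s \<noteq> {}) \<and>
     (\<forall>s\<in>K. \<forall>t. t \<subseteq> s \<and> t \<noteq> {} \<longrightarrow> t \<in> K)"

definition vertices :: "'a set set \<Rightarrow> 'a set" where
  "vertices K = {x. {x} \<in> K}"

definition link :: "'a set set \<Rightarrow> 'a set \<Rightarrow> 'a set set" where
  "link K s = {t \<in> K. s \<union> t \<in> K \<and> s \<inter> t = {}}"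

definition boundary :: "'a set \<Rightarrow> 'a set set" where
  "boundary s = {t. t \<subseteq> s \<and> t \<noteq> {} \<and> t \<noteq> s}"

definition star_compl :: "'a set set \<Rightarrow> 'a set \<Rightarrow> 'a set set" where
  "star_compl K s = {t \<in> K. \<not> s \<subseteq> t}"

text \<open>The join is only meaningful for complexes with disjoint vertex sets; the lemmas
  \<open>vertices_link_boundary_disjoint\<close> and \<open>vertices_join_apex_disjoint\<close> below show that this
  condition holds for both joins in the stellar subdivision.\<close>

definition join :: "'a set set \<Rightarrow> 'a set set \<Rightarrow> 'a set set" (infixl "\<star>" 65) where
  "A \<star> B = {a \<union> b | a b. a \<in> A \<union> {{}} \<and> b \<in> B \<union> {{}} \<and> a \<union> b \<noteq> {}}"

text \<open>The complex with the single face \<open>{x}\<close> is the set of sets \<open>{{x}}\<close>.\<close>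

definition stellar_subdivision :: "'a set set \<Rightarrow> 'a set \<Rightarrow> 'a \<Rightarrow> 'a set set" where
  "stellar_subdivision K s x = star_compl K s \<union> (link K s \<star> boundary s \<star> {{x}})"

lemma vertices_link_boundary_disjoint:
  "vertices (link K s) \<inter> vertices (boundary s) = {}"
  by (auto simp: vertices_def link_def boundary_def)

lemma vertices_join_apex_disjoint:
  assumes "simplicial_complex K" "s \<in> K" "x \<notin> vertices K"
  shows "vertices (link K s \<star> boundary s) \<inter> vertices {{x}} = {}"
proof -
  have K: "x \<notin> \<Union>K"
  proof
    assume "x \<in> \<Union>K"
    then obtain t where t: "t \<in> K" "{x} \<subseteq> t" by auto
    have "{x} \<in> K"
      using assms(1) t unfolding simplicial_complex_def by (metis insert_not_empty)
    with assms(3) show False by (simp add: vertices_def)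
  qed
  have "t \<subseteq> \<Union>A \<union> \<Union>B" if "t \<in> A \<star> B" for t and A B :: "'a set set"
    using that by (auto simp: join_def)
  moreover have "\<Union>(link K s) \<subseteq> \<Union>K"
    by (auto simp: link_def)
  moreover have "\<Union>(boundary s) \<subseteq> \<Union>K"
    using assms(2) by (auto simp: boundary_def)
  ultimately have "t \<subseteq> \<Union>K" if "t \<in> link K s \<star> boundary s" for t
    using that by (meson Un_least order_trans)
  with K have "{x} \<notin> link K s \<star> boundary s"
    by (metis insert_subset)
  then show ?thesis
    by (simp add: vertices_def)
qed

end

theory Submission
  imports Defs
begin

text \<open>Subdividing keeps the faces of \<open>K\<close> that do not contain \<open>s\<close> and
  cones off the rest with the new point \<open>x\<close>; putting \<open>s\<close> back in place of
  \<open>x\<close> undoes this. A face from the join part is a \<union> b \<union> c with a in the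
  link or empty, b \<subseteq> s and c \<subseteq> {x}. Replacing x by s absorbs b and leaves s
  \<union> a, a face of \<open>K\<close> by definition of the link; without x, the face already lies
  inside s \<union> a. Conversely, a face t \<supseteq> s is recovered from {x} \<union> (t - s).
  Throughout, x lies in no face of \<open>K\<close> (\<open>not_vertex_notin_face\<close>), so
  removing x never damages an old face.\<close>

lemma simplicial_complex_subset:
  assumes "simplicial_complex K" "t \<in> K" "u \<subseteq> t" "u \<noteq> {}"
  shows "u \<in> K"
  using assms unfolding simplicial_complex_def by blast

lemma not_vertex_notin_face:
  assumes "simplicial_complex K" "x \<notin> vertices K" "t \<in> K"
  shows "x \<notin> t"
  using assms simplicial_complex_subset[of K t "{x}"] by (auto simp: vertices_def)

lemma in_join_iff: "t \<in> A \<star> B \<longleftrightarrow>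
    t \<noteq> {} \<and> (\<exists>a\<in>insert {} A. \<exists>b\<in>insert {} B. t = a \<union> b)"
  unfolding join_def by blast

lemma in_join_apexE:
  assumes "t \<in> A \<star> B \<star> {{x}}"
  obtains a b c where "t = a \<union> b \<union> c" "a \<in> insert {} A" "b \<in> insert {} B" "c \<in> {{}, {x}}"
proof -
  obtain d c where d: "d \<in> insert {} (A \<star> B)" and c: "c \<in> {{}, {x}}" and t: "t = d \<union> c"
    using assms unfolding in_join_iff[of t] by blast
  obtain a b where "a \<in> insert {} A" "b \<in> insert {} B" "d = a \<union> b"
    using d by (auto simp: in_join_iff)
  with c t that show thesis by simp
qed

text \<open>Choosing the empty part of \<open>B\<close> is enough, since recovering a face
  containing \<open>s\<close> needs no piece of the boundary of \<open>s\<close>. The case of empty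
  \<open>a\<close> yields the apex {x} itself.\<close>

lemma insert_apex_in_join:
  assumes "a \<in> insert {} A"
  shows "insert x a \<in> A \<star> B \<star> {{x}}"
proof -
  have "a \<in> insert {} (A \<star> B)"
    using assms by (auto simp: in_join_iff)
  moreover have "insert x a = a \<union> {x}" by simp
  ultimately show ?thesis
    unfolding in_join_iff[of "insert x a"] by blast
qed

theorem proposition3p1:
  fixes K :: "'a set set" and s :: "'a set" and x :: 'a
  assumes "simplicial_complex K" and "s \<in> K" and "x \<notin> vertices K"
  shows "K = {t. t \<in> stellar_subdivision K s x \<and> x \<notin> t}
             \<union> {s \<union> (t - {x}) | t. t \<in> stellar_subdivision K s x \<and> x \<in> t}
       \<and> {t. t \<in> stellar_subdivision K s x \<and> x \<notin> t}
             \<union> {s \<union> (t - {x}) | t. t \<in> stellar_subdivision K s x \<and> x \<in> t}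
         = star_compl (stellar_subdivision K s x) {x}
             \<union> {s \<union> (t - {x}) | t. t \<in> stellar_subdivision K s x \<and> x \<in> t}"
proof -
  let ?S = "stellar_subdivision K s x"
  have face: "(x \<notin> t \<longrightarrow> t \<in> K) \<and> (x \<in> t \<longrightarrow> s \<union> (t - {x}) \<in> K)" if t: "t \<in> ?S" for t
  proof (cases "t \<in> K")
    case True
    then show ?thesis using not_vertex_notin_face assms by metis
  next
    case False
    then have j: "t \<in> link K s \<star> boundary s \<star> {{x}}"
      using t by (auto simp: stellar_subdivision_def star_compl_def)
    then obtain a b c where abc: "t = a \<union> b \<union> c" "a \<in> insert {} (link K s)"
      "b \<in> insert {} (boundary s)" "c \<in> {{}, {x}}"
      by (rule in_join_apexE)
    have sa: "s \<union> a \<in> K" and b: "b \<subseteq> s"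
      using abc assms(2) by (auto simp: link_def boundary_def)
    have x: "x \<notin> s \<union> a"
      using not_vertex_notin_face[OF assms(1,3) sa] .
    \<comment> \<open>Here c is empty, so t = a \<union> b lies inside the face s \<union>
      a.\<close>
    have "t \<in> K" if "x \<notin> t"
    proof (rule simplicial_complex_subset[OF assms(1) sa])
      show "t \<subseteq> s \<union> a" using abc b that by auto
      show "t \<noteq> {}" using j by (simp add: in_join_iff)
    qed
    moreover have "s \<union> (t - {x}) = s \<union> a"
      using abc b x by auto
    ultimately show ?thesis using sa by simp
  qed
  have lift: "\<exists>u\<in>?S. x \<in> u \<and> t = s \<union> (u - {x})" if t: "t \<in> K" "s \<subseteq> t" for t
  proof
    \<comment> \<open>The empty case is t = s, whose preimage is the new vertex {x}.\<close>
    have "t - s \<in> insert {} (link K s)"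
      using t simplicial_complex_subset[OF assms(1) t(1), of "t - s"]
      by (auto simp: link_def Un_absorb1)
    then show "insert x (t - s) \<in> ?S"
      by (simp add: stellar_subdivision_def insert_apex_in_join)
    show "x \<in> insert x (t - s) \<and> t = s \<union> (insert x (t - s) - {x})"
      using t not_vertex_notin_face[OF assms(1,3) t(1)] by auto
  qed
  have keep: "t \<in> ?S \<and> x \<notin> t" if "t \<in> K" "\<not> s \<subseteq> t" for t
    using that not_vertex_notin_face[OF assms(1,3) that(1)]
    by (simp add: stellar_subdivision_def star_compl_def)
  have "K = {t. t \<in> ?S \<and> x \<notin> t} \<union> {s \<union> (t - {x}) | t. t \<in> ?S \<and> x \<in> t}" (is "K = ?R")
  proof (intro equalityI subsetI)
    fix t assume "t \<in> K"
    then show "t \<in> ?R" using lift[of t] keep[of t] by (cases "s \<subseteq> t") auto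
  next
    fix t assume "t \<in> ?R"
    then show "t \<in> K" using face by auto
  qed
  \<comment> \<open>The second equation is only the definition, as {x} \<subseteq> t means x \<in>
    t.\<close>
  moreover have "{t. t \<in> ?S \<and> x \<notin> t} = star_compl ?S {x}"
    by (simp add: star_compl_def)
  ultimately show ?thesis by simp
qed

end
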